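(* For every generalized metric space $X$, the Isbell completion $I(X)$ is both (categorically) complete and cocomplete, and the Yoneda embedding $X\to I(X)$, $x\mapsto (d_X(-,x),d_X(x,-))$, is both (categorically) continuous and cocontinuous.
   Context: A generalized metric space is a set $X$ with a function $d_X\colon X\times X\to[0,\infty]$ such that $d_X(x,x)=0$ and $d_X(x,y)+d_X(y,z)\ge d_X(x,z)$ for all $x,y,z\in X$ (no symmetry, separation or finiteness is required). For $a,b\in[0,\infty]$ write $b\dot{-}a:=\max(b-a,0)$ (truncated difference, with $\infty\dot{-}\infty=0$); $[0,\infty]$ is a generalized metric space with $d(a,b)=b\dot{-}a$. The opposite $X^{\mathrm{op}}$ has the same points and $d_{X^{\mathrm{op}}}(x,y)=d_X(y,x)$. A short map $F\colon X\to Y$ is a function with $d_X(x,x')\ge d_Y(F(x),F(x'))$ for all $x,x'$. Points $x,x'$ are isomorphic, $x\simeq x'$, if $d(x,x')=0=d(x',x)$. A presheaf on $X$ is a short map $f\colon X^{\mathrm{op}}\to[0,\infty]$; the space $\widehat X$ of presheaves has metric $d_{\widehat X}(f,f')=\sup_{x\in X}(f'(x)\dot{-}f(x))$. A co-presheaf is a short map $g\colon X\to[0,\infty]$; the space $\check X$ of co-presheaves has metric $d_{\check X}(g,g')=\sup_{x\in X}(g'(x)\dot{-}g(x))$. Define $L\colon\widehat X\to\check X^{\mathrm{op}}$ and $R\colon\check X^{\mathrm{op}}\to\widehat X$ by $L(f)(y)=\sup_{x\in X}(d_X(x,y)\dot{-}f(x))$ and $R(g)(x)=\sup_{y\in X}(d_X(x,y)\dot{-}g(y))$.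 The Isbell completion is $I(X)=\{(f,g)\in\widehat X\times\check X^{\mathrm{op}}\mid L(f)=g,\ R(g)=f\}$ with metric $d_{I(X)}((f,g),(f',g'))=\max\{d_{\widehat X}(f,f'),\,d_{\check X^{\mathrm{op}}}(g,g')\}$. Let $Z$ be a generalized metric space, $D$ a generalized metric space (a shape), and $J\colon D\to Z$ a short map (a diagram). Given a weighting, i.e. a presheaf $W\colon D^{\mathrm{op}}\to[0,\infty]$, a colimit of $J$ weighted by $W$ is a point $c\in Z$ with $d_Z(c,z)=\sup_{d\in D}(d_Z(J(d),z)\dot{-}W(d))$ for all $z\in Z$; write $c\simeq\operatorname{colim}_W(J)$. Given a co-presheaf $W\colon D\to[0,\infty]$, a limit of $J$ weighted by $W$ is a point $l\in Z$ with $d_Z(z,l)=\sup_{d\in D}(d_Z(z,J(d))\dot{-}W(d))$ for all $z\in Z$; write $l\simeq\lim_W(J)$. $Z$ is cocomplete (resp. complete) if colimits (resp. limits) exist for all shapes, diagrams and weightings. A short map $F$ is cocontinuous (resp. continuous) if $F(\operatorname{colim}_W(J))\simeq\operatorname{colim}_W(F\circ J)$ (resp. $F(\lim_W(J))\simeq\lim_W(F\circ J)$) whenever the colimit of $J$ (resp. limit of $J$) exists. *)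

theory Defs
  imports "HOL-Library.Extended_Nonnegative_Real" "HOL-Library.FuncSet"
begin

record 'a gms =
  points :: "'a set"
  gdist :: "'a \<Rightarrow> 'a \<Rightarrow> ennreal"

definition gen_metric_space :: "'a gms \<Rightarrow> bool" where
  "gen_metric_space X \<longleftrightarrow>
     (\<forall>x\<in>points X. gdist X x x = 0) \<and>
     (\<forall>x\<in>points X. \<forall>y\<in>points X. \<forall>z\<in>points X.
        gdist X x z \<le> gdist X x y + gdist X y z)"

text \<open>
  Subtraction on \<^typ>\<open>ennreal\<close> already truncates at 0, but it yields
  \<open>\<infinity> - \<infinity> = \<infinity>\<close>, whereas here the truncated difference of \<open>\<infinity>\<close> with
  itself has to be 0.
\<close>

definition tdiff :: "ennreal \<Rightarrow> ennreal \<Rightarrow> ennreal" (infixl "\<ominus>" 65) where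
  "b \<ominus> a = (if b \<le> a then 0 else b - a)"

definition ennreal_gms :: "ennreal gms" where
  "ennreal_gms = \<lparr>points = UNIV, gdist = (\<lambda>a b. b \<ominus> a)\<rparr>"

definition op_gms :: "'a gms \<Rightarrow> 'a gms" where
  "op_gms X = \<lparr>points = points X, gdist = (\<lambda>x y. gdist X y x)\<rparr>"

definition short_map :: "'a gms \<Rightarrow> 'b gms \<Rightarrow> ('a \<Rightarrow> 'b) \<Rightarrow> bool" where
  "short_map X Y F \<longleftrightarrow>
     F \<in> points X \<rightarrow> points Y \<and>
     (\<forall>x\<in>points X. \<forall>x'\<in>points X. gdist Y (F x) (F x') \<le> gdist X x x')"

definition presheaf :: "'a gms \<Rightarrow> ('a \<Rightarrow> ennreal) \<Rightarrow> bool" where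
  "presheaf X f \<longleftrightarrow> short_map (op_gms X) ennreal_gms f"

definition copresheaf :: "'a gms \<Rightarrow> ('a \<Rightarrow> ennreal) \<Rightarrow> bool" where
  "copresheaf X g \<longleftrightarrow> short_map X ennreal_gms g"

text \<open>
  The points of the spaces below are functions on the carrier of \<open>X\<close>; they are
  represented by the extensional functions, so that HOL equality of points is equality
  on the carrier. The supremum of the empty family is 0 in \<^typ>\<open>ennreal\<close>, as it
  should be in \<open>[0,\<infinity>]\<close>.
\<close>

definition presheaf_space :: "'a gms \<Rightarrow> ('a \<Rightarrow> ennreal) gms" where
  "presheaf_space X =
     \<lparr>points = {f \<in> extensional (points X). presheaf X f},
      gdist = (\<lambda>f f'. SUP x\<in>points X. f' x \<ominus> f x)\<rparr>"

definition copresheaf_space :: "'a gms \<Rightarrow> ('a \<Rightarrow> ennreal) gms" where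
  "copresheaf_space X =
     \<lparr>points = {g \<in> extensional (points X). copresheaf X g},
      gdist = (\<lambda>g g'. SUP x\<in>points X. g' x \<ominus> g x)\<rparr>"

definition isbell_L :: "'a gms \<Rightarrow> ('a \<Rightarrow> ennreal) \<Rightarrow> 'a \<Rightarrow> ennreal" where
  "isbell_L X f = (\<lambda>y\<in>points X. SUP x\<in>points X. gdist X x y \<ominus> f x)"

definition isbell_R :: "'a gms \<Rightarrow> ('a \<Rightarrow> ennreal) \<Rightarrow> 'a \<Rightarrow> ennreal" where
  "isbell_R X g = (\<lambda>x\<in>points X. SUP y\<in>points X. gdist X x y \<ominus> g y)"

definition isbell_completion :: "'a gms \<Rightarrow> (('a \<Rightarrow> ennreal) \<times> ('a \<Rightarrow> ennreal)) gms" where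
  "isbell_completion X =
     \<lparr>points = {(f, g). f \<in> points (presheaf_space X) \<and>
                        g \<in> points (op_gms (copresheaf_space X)) \<and>
                        isbell_L X f = g \<and> isbell_R X g = f},
      gdist = (\<lambda>(f, g) (f', g').
                 max (gdist (presheaf_space X) f f')
                     (gdist (op_gms (copresheaf_space X)) g g'))\<rparr>"

definition yoneda :: "'a gms \<Rightarrow> 'a \<Rightarrow> ('a \<Rightarrow> ennreal) \<times> ('a \<Rightarrow> ennreal)" where
  "yoneda X x = ((\<lambda>y\<in>points X. gdist X y x), (\<lambda>y\<in>points X. gdist X x y))"

definition is_colimit ::
  "'z gms \<Rightarrow> 'd gms \<Rightarrow> ('d \<Rightarrow> 'z) \<Rightarrow> ('d \<Rightarrow> ennreal) \<Rightarrow> 'z \<Rightarrow> bool" where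
  "is_colimit Z D J W c \<longleftrightarrow>
     c \<in> points Z \<and>
     (\<forall>z\<in>points Z. gdist Z c z = (SUP d\<in>points D. gdist Z (J d) z \<ominus> W d))"

definition is_limit ::
  "'z gms \<Rightarrow> 'd gms \<Rightarrow> ('d \<Rightarrow> 'z) \<Rightarrow> ('d \<Rightarrow> ennreal) \<Rightarrow> 'z \<Rightarrow> bool" where
  "is_limit Z D J W l \<longleftrightarrow>
     l \<in> points Z \<and>
     (\<forall>z\<in>points Z. gdist Z z l = (SUP d\<in>points D. gdist Z z (J d) \<ominus> W d))"

text \<open>
  HOL cannot quantify over types inside a definition, so the four notions below take the
  type \<open>'d\<close> from which the points of the shapes are drawn as a parameter. Shapes of
  arbitrary size are covered by leaving \<open>'d\<close> free in a theorem.
\<close>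

definition gms_cocomplete :: "'d itself \<Rightarrow> 'z gms \<Rightarrow> bool" where
  "gms_cocomplete _ Z \<longleftrightarrow>
     gen_metric_space Z \<and>
     (\<forall>(D :: 'd gms) J W.
        gen_metric_space D \<and> short_map D Z J \<and> presheaf D W \<longrightarrow>
        (\<exists>c. is_colimit Z D J W c))"

definition gms_complete :: "'d itself \<Rightarrow> 'z gms \<Rightarrow> bool" where
  "gms_complete _ Z \<longleftrightarrow>
     gen_metric_space Z \<and>
     (\<forall>(D :: 'd gms) J W.
        gen_metric_space D \<and> short_map D Z J \<and> copresheaf D W \<longrightarrow>
        (\<exists>l. is_limit Z D J W l))"

definition gms_cocontinuous ::
  "'d itself \<Rightarrow> 'y gms \<Rightarrow> 'z gms \<Rightarrow> ('y \<Rightarrow> 'z) \<Rightarrow> bool" where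
  "gms_cocontinuous _ Y Z F \<longleftrightarrow>
     short_map Y Z F \<and>
     (\<forall>(D :: 'd gms) J W c.
        gen_metric_space D \<and> short_map D Y J \<and> presheaf D W \<and> is_colimit Y D J W c \<longrightarrow>
        is_colimit Z D (F \<circ> J) W (F c))"

definition gms_continuous ::
  "'d itself \<Rightarrow> 'y gms \<Rightarrow> 'z gms \<Rightarrow> ('y \<Rightarrow> 'z) \<Rightarrow> bool" where
  "gms_continuous _ Y Z F \<longleftrightarrow>
     short_map Y Z F \<and>
     (\<forall>(D :: 'd gms) J W l.
        gen_metric_space D \<and> short_map D Y J \<and> copresheaf D W \<and> is_limit Y D J W l \<longrightarrow>
        is_limit Z D (F \<circ> J) W (F l))"

end

theory Submission
  imports Defs
begin

text \<open>
  Everything rests on the residuation law \<open>b \<ominus> a \<le> c \<longleftrightarrow> b \<le> c + a\<close>: suprema of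
  truncated differences are identified by comparing their upper bounds, and each such
  comparison becomes a family of additive inequalities. In this form \<open>L\<close> and \<open>R\<close> are the
  two halves of a Galois connection, because \<open>L f \<le> g\<close> and \<open>R g \<le> f\<close> both say that
  \<open>d(x,y) \<le> g y + f x\<close> throughout. It follows that the distance of two points of the
  Isbell completion is determined by their copresheaf components
  (\<open>isbell_dist_le_iff_snd\<close>).

  For a diagram \<open>J d = (f\<^sub>d, g\<^sub>d)\<close> with weighting \<open>W\<close>, the copresheaf description shows
  that a point \<open>(f, g)\<close> is a colimit as soon as \<open>g y = (SUP d. g\<^sub>d y \<ominus> W d)\<close>
  (\<open>is_colimit_isbellI\<close>). A point with this second component exists: writing \<open>h\<close> for
  the right-hand side, one always has \<open>L (R h) \<le> h\<close>, and the converse follows from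
  \<open>R h \<le> f\<^sub>d + W d\<close>, so that \<open>(R h, h)\<close> is a point of the completion
  (\<open>isbell_colimit_exists\<close>). The Yoneda embedding is cocontinuous because the defining
  equation of a colimit \<open>c\<close> in \<open>X\<close> is precisely this criterion for the second component
  \<open>d(c,-)\<close> of the image of \<open>c\<close>.

  The statements on limits are those on colimits for the opposite space, since swapping
  components identifies the opposite of the completion of \<open>X\<close> with the completion of the
  opposite of \<open>X\<close> (\<open>is_limit_isbell_iff\<close>).
\<close>

section \<open>Residuation\<close>

text \<open>The case \<open>a = \<infinity>\<close> is where the convention \<open>\<infinity> \<ominus> \<infinity> = 0\<close> matters.\<close>

lemma tdiff_le_iff: "b \<ominus> a \<le> c \<longleftrightarrow> b \<le> c + a"
proof (cases "b \<le> a")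
  case True
  then show ?thesis
    by (simp add: tdiff_def add_increasing)
next
  case False
  then have "a \<noteq> top"
    by auto
  with False show ?thesis
    by (simp add: tdiff_def ennreal_minus_le_iff add.commute)
qed

lemma SUP_tdiff_le_iff:
  "(SUP i\<in>I. b i \<ominus> a i) \<le> c \<longleftrightarrow> (\<forall>i\<in>I. b i \<le> c + a i)"
  by (simp add: SUP_le_iff tdiff_le_iff)

lemma eq_by_upper_bounds:
  fixes a b :: "'b::order"
  assumes "\<And>c. a \<le> c \<longleftrightarrow> b \<le> c"
  shows "a = b"
  using assms[of a] assms[of b] by simp

section \<open>The Isbell adjunction\<close>

lemma points_op [simp]: "points (op_gms X) = points X"
  by (simp add: op_gms_def)

lemma gdist_op [simp]: "gdist (op_gms X) x y = gdist X y x"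
  by (simp add: op_gms_def)

lemma op_op [simp]: "op_gms (op_gms X) = X"
  by (simp add: op_gms_def)

lemma gdist_refl: "gen_metric_space X \<Longrightarrow> x \<in> points X \<Longrightarrow> gdist X x x = 0"
  by (simp add: gen_metric_space_def)

lemma gdist_triangle:
  "gen_metric_space X \<Longrightarrow> x \<in> points X \<Longrightarrow> y \<in> points X \<Longrightarrow> z \<in> points X \<Longrightarrow>
     gdist X x z \<le> gdist X x y + gdist X y z"
  by (simp add: gen_metric_space_def)

lemma gen_metric_space_op [simp]: "gen_metric_space (op_gms X) \<longleftrightarrow> gen_metric_space X"
proof -
  have "gen_metric_space (op_gms Y)" if Y: "gen_metric_space Y" for Y :: "'a gms"
    unfolding gen_metric_space_def points_op gdist_op
  proof (intro conjI ballI)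
    fix x y z assume "x \<in> points Y" "y \<in> points Y" "z \<in> points Y"
    then show "gdist Y z x \<le> gdist Y y x + gdist Y z y"
      using gdist_triangle[OF Y, of z y x] by (simp add: add.commute)
  qed (rule gdist_refl[OF Y])
  from this[of X] this[of "op_gms X"] show ?thesis
    by auto
qed

lemma copresheaf_op [simp]: "copresheaf (op_gms X) = presheaf X"
  by (simp add: fun_eq_iff presheaf_def copresheaf_def)

lemma presheaf_op [simp]: "presheaf (op_gms X) = copresheaf X"
  by (simp add: fun_eq_iff presheaf_def copresheaf_def)

lemma copresheaf_iff:
  "copresheaf X g \<longleftrightarrow> (\<forall>x\<in>points X. \<forall>y\<in>points X. g y \<le> gdist X x y + g x)"
  by (simp add: copresheaf_def short_map_def ennreal_gms_def tdiff_le_iff)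

lemma isbell_L_op [simp]: "isbell_L (op_gms X) = isbell_R X"
  by (simp add: fun_eq_iff isbell_L_def isbell_R_def)

lemma isbell_R_op [simp]: "isbell_R (op_gms X) = isbell_L X"
  by (simp add: fun_eq_iff isbell_L_def isbell_R_def)

lemma isbell_L_extensional [simp]: "isbell_L X f \<in> extensional (points X)"
  by (simp add: isbell_L_def)

lemma isbell_L_le_iff:
  "y \<in> points X \<Longrightarrow> isbell_L X f y \<le> c \<longleftrightarrow> (\<forall>x\<in>points X. gdist X x y \<le> c + f x)"
  by (simp add: isbell_L_def SUP_tdiff_le_iff)

lemma isbell_R_le_iff:
  "x \<in> points X \<Longrightarrow> isbell_R X g x \<le> c \<longleftrightarrow> (\<forall>y\<in>points X. gdist X x y \<le> c + g y)"
  by (simp add: isbell_R_def SUP_tdiff_le_iff)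

lemma gdist_le_L_add:
  "x \<in> points X \<Longrightarrow> y \<in> points X \<Longrightarrow> gdist X x y \<le> isbell_L X f y + f x"
  using isbell_L_le_iff[of y X f "isbell_L X f y"] by simp

lemma gdist_le_R_add:
  "x \<in> points X \<Longrightarrow> y \<in> points X \<Longrightarrow> gdist X x y \<le> isbell_R X g x + g y"
  using isbell_R_le_iff[of x X g "isbell_R X g x"] by simp

lemma copresheaf_isbell_L:
  assumes X: "gen_metric_space X"
  shows "copresheaf X (isbell_L X f)"
  unfolding copresheaf_iff
proof (intro ballI)
  fix x y assume xy: "x \<in> points X" "y \<in> points X"
  have "gdist X u y \<le> gdist X x y + isbell_L X f x + f u" if u: "u \<in> points X" for u
  proof -
    have "gdist X u y \<le> gdist X u x + gdist X x y"
      using gdist_triangle[OF X] u xy by blast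
    also have "\<dots> \<le> (isbell_L X f x + f u) + gdist X x y"
      by (intro add_right_mono gdist_le_L_add u xy)
    finally show ?thesis
      by (simp add: ac_simps)
  qed
  then show "isbell_L X f y \<le> gdist X x y + isbell_L X f x"
    using xy by (simp add: isbell_L_le_iff)
qed

section \<open>Points and distances of the Isbell completion\<close>

lemma mem_isbell_iff:
  assumes X: "gen_metric_space X"
  shows "p \<in> points (isbell_completion X) \<longleftrightarrow>
           isbell_L X (fst p) = snd p \<and> isbell_R X (snd p) = fst p"
proof -
  have "isbell_L X (fst p) \<in> points (copresheaf_space X)"
    using copresheaf_isbell_L[OF X] by (simp add: copresheaf_space_def)
  moreover have "isbell_R X (snd p) \<in> points (presheaf_space X)"
    using copresheaf_isbell_L[of "op_gms X"] isbell_L_extensional[of "op_gms X"] X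
    by (simp add: presheaf_space_def)
  ultimately show ?thesis
    by (cases p) (auto simp: isbell_completion_def)
qed

lemma gdist_isbell_le_iff:
  "gdist (isbell_completion X) p q \<le> c \<longleftrightarrow>
     (\<forall>x\<in>points X. fst q x \<le> c + fst p x) \<and> (\<forall>y\<in>points X. snd p y \<le> c + snd q y)"
  by (cases p; cases q)
     (simp add: isbell_completion_def presheaf_space_def copresheaf_space_def
        SUP_tdiff_le_iff)

text \<open>
  The adjunction, with an offset \<open>c\<close>: for \<open>p = (f, L f)\<close> and \<open>q = (R g, g)\<close>, both sides
  say that \<open>d(x,y) \<le> c + f x + g y\<close> for all \<open>x\<close> and \<open>y\<close>.
\<close>

lemma isbell_fst_iff_snd:
  assumes X: "gen_metric_space X"
    and p: "p \<in> points (isbell_completion X)" and q: "q \<in> points (isbell_completion X)"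
  shows "(\<forall>x\<in>points X. fst q x \<le> c + fst p x) \<longleftrightarrow>
           (\<forall>y\<in>points X. snd p y \<le> c + snd q y)"
proof -
  have L: "snd p = isbell_L X (fst p)" and R: "fst q = isbell_R X (snd q)"
    using p q mem_isbell_iff[OF X] by auto
  have "(\<forall>x\<in>points X. fst q x \<le> c + fst p x) \<longleftrightarrow>
          (\<forall>x\<in>points X. \<forall>y\<in>points X. gdist X x y \<le> c + fst p x + snd q y)"
    unfolding R by (simp add: isbell_R_le_iff)
  also have "\<dots> \<longleftrightarrow> (\<forall>y\<in>points X. snd p y \<le> c + snd q y)"
    unfolding L by (simp add: isbell_L_le_iff ac_simps) blast
  finally show ?thesis .
qed

lemma isbell_dist_le_iff_snd:
  assumes "gen_metric_space X"
    and "p \<in> points (isbell_completion X)" "q \<in> points (isbell_completion X)"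
  shows "gdist (isbell_completion X) p q \<le> c \<longleftrightarrow>
           (\<forall>y\<in>points X. snd p y \<le> c + snd q y)"
  using isbell_fst_iff_snd[OF assms] by (simp add: gdist_isbell_le_iff)

lemma gen_metric_space_isbell:
  assumes X: "gen_metric_space X"
  shows "gen_metric_space (isbell_completion X)"
proof -
  let ?I = "isbell_completion X"
  have snd_le: "snd p y \<le> gdist ?I p q + snd q y"
    if "p \<in> points ?I" "q \<in> points ?I" "y \<in> points X" for p q y
    using isbell_dist_le_iff_snd[OF X that(1,2), of "gdist ?I p q"] that(3) by simp
  have "gdist ?I p p = 0" for p
    using gdist_isbell_le_iff[of X p p 0] by simp
  moreover have "gdist ?I p r \<le> gdist ?I p q + gdist ?I q r"
    if pqr: "p \<in> points ?I" "q \<in> points ?I" "r \<in> points ?I" for p q r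
    unfolding isbell_dist_le_iff_snd[OF X pqr(1,3)]
  proof
    fix y assume y: "y \<in> points X"
    have "snd p y \<le> gdist ?I p q + snd q y"
      by (rule snd_le[OF pqr(1,2) y])
    also have "\<dots> \<le> gdist ?I p q + (gdist ?I q r + snd r y)"
      by (intro add_left_mono snd_le[OF pqr(2,3) y])
    finally show "snd p y \<le> gdist ?I p q + gdist ?I q r + snd r y"
      by (simp add: ac_simps)
  qed
  ultimately show ?thesis
    by (auto simp: gen_metric_space_def)
qed

section \<open>Colimits in the Isbell completion\<close>

text \<open>
  Distances in the completion can be computed from copresheaf components, and there the
  weighted supremum over the diagram commutes with the supremum over the points of \<open>X\<close>.
\<close>

lemma is_colimit_isbellI:
  assumes X: "gen_metric_space X"
    and J: "J \<in> points D \<rightarrow> points (isbell_completion X)"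
    and c: "c \<in> points (isbell_completion X)"
    and snd_c: "\<And>y. y \<in> points X \<Longrightarrow> snd c y = (SUP d\<in>points D. snd (J d) y \<ominus> W d)"
  shows "is_colimit (isbell_completion X) D J W c"
  unfolding is_colimit_def
proof (intro conjI ballI)
  fix z assume z: "z \<in> points (isbell_completion X)"
  show "gdist (isbell_completion X) c z =
          (SUP d\<in>points D. gdist (isbell_completion X) (J d) z \<ominus> W d)"
  proof (rule eq_by_upper_bounds)
    fix r
    have J': "J d \<in> points (isbell_completion X)" if "d \<in> points D" for d
      using J that by blast
    have "gdist (isbell_completion X) c z \<le> r \<longleftrightarrow>
            (\<forall>y\<in>points X. \<forall>d\<in>points D. snd (J d) y \<le> r + snd z y + W d)"
      by (simp add: isbell_dist_le_iff_snd[OF X c z] snd_c SUP_tdiff_le_iff)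
    also have "\<dots> \<longleftrightarrow> (\<forall>d\<in>points D. \<forall>y\<in>points X. snd (J d) y \<le> (r + W d) + snd z y)"
      by (simp add: ac_simps) blast
    also have "\<dots> \<longleftrightarrow>
        (SUP d\<in>points D. gdist (isbell_completion X) (J d) z \<ominus> W d) \<le> r"
      by (simp add: SUP_tdiff_le_iff isbell_dist_le_iff_snd[OF X J' z])
    finally show "gdist (isbell_completion X) c z \<le> r \<longleftrightarrow>
        (SUP d\<in>points D. gdist (isbell_completion X) (J d) z \<ominus> W d) \<le> r" .
  qed
qed (rule c)

lemma isbell_colimit_exists:
  assumes X: "gen_metric_space X"
    and J: "J \<in> points D \<rightarrow> points (isbell_completion X)"
  shows "\<exists>c. is_colimit (isbell_completion X) D J W c"
proof -
  define h where "h = (\<lambda>y\<in>points X. SUP d\<in>points D. snd (J d) y \<ominus> W d)"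
  have h_eq: "h y = (SUP d\<in>points D. snd (J d) y \<ominus> W d)" if "y \<in> points X" for y
    using that by (simp add: h_def)
  have snd_le: "snd (J d) y \<le> h y + W d" if "d \<in> points D" "y \<in> points X" for d y
    using SUP_tdiff_le_iff[of "\<lambda>d. snd (J d) y" W "points D" "h y"] h_eq that by simp
  have L: "snd (J d) = isbell_L X (fst (J d))" if "d \<in> points D" for d
    using funcset_mem[OF J that] by (simp add: mem_isbell_iff[OF X])
  have R_le: "isbell_R X h x \<le> fst (J d) x + W d" if d: "d \<in> points D" and x: "x \<in> points X"
    for d x
    unfolding isbell_R_le_iff[OF x]
  proof
    fix y assume y: "y \<in> points X"
    have "gdist X x y \<le> snd (J d) y + fst (J d) x"
      using gdist_le_L_add[OF x y] L[OF d] by simp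
    also have "\<dots> \<le> (h y + W d) + fst (J d) x"
      using snd_le[OF d y] by (rule add_right_mono)
    finally show "gdist X x y \<le> fst (J d) x + W d + h y"
      by (simp add: ac_simps)
  qed
  have "isbell_L X (isbell_R X h) y = h y" if y: "y \<in> points X" for y
  proof (rule antisym)
    show "isbell_L X (isbell_R X h) y \<le> h y"
      using gdist_le_R_add[of _ X y h] y by (simp add: isbell_L_le_iff add.commute)
    have "snd (J d) y \<le> isbell_L X (isbell_R X h) y + W d" if d: "d \<in> points D" for d
      unfolding L[OF d] isbell_L_le_iff[OF y]
    proof
      fix x assume x: "x \<in> points X"
      have "gdist X x y \<le> isbell_L X (isbell_R X h) y + isbell_R X h x"
        by (rule gdist_le_L_add[OF x y])
      also have "\<dots> \<le> isbell_L X (isbell_R X h) y + (fst (J d) x + W d)"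
        using R_le[OF d x] by (rule add_left_mono)
      finally show "gdist X x y \<le> isbell_L X (isbell_R X h) y + W d + fst (J d) x"
        by (simp add: ac_simps)
    qed
    then show "h y \<le> isbell_L X (isbell_R X h) y"
      by (simp add: h_eq[OF y] SUP_tdiff_le_iff)
  qed
  then have "isbell_L X (isbell_R X h) = h"
    by (intro extensionalityI[of _ "points X"]) (auto simp: h_def)
  then have "(isbell_R X h, h) \<in> points (isbell_completion X)"
    by (simp add: mem_isbell_iff[OF X])
  then have "is_colimit (isbell_completion X) D J W (isbell_R X h, h)"
    by (rule is_colimit_isbellI[OF X J]) (simp add: h_eq)
  then show ?thesis ..
qed

section \<open>The Yoneda embedding\<close>

text \<open>
  Both components of the image of \<open>x\<close> are representable, so \<open>L\<close> and \<open>R\<close> exchange them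
  by the triangle inequality, with the supremum attained at \<open>x\<close> itself.
\<close>

lemma isbell_L_representable:
  assumes X: "gen_metric_space X" and x: "x \<in> points X"
  shows "isbell_L X (\<lambda>y\<in>points X. gdist X y x) = (\<lambda>y\<in>points X. gdist X x y)"
proof (rule extensionalityI[of _ "points X"])
  fix y assume y: "y \<in> points X"
  have "isbell_L X (\<lambda>y\<in>points X. gdist X y x) y = gdist X x y"
  proof (rule antisym)
    show "isbell_L X (\<lambda>y\<in>points X. gdist X y x) y \<le> gdist X x y"
      using gdist_triangle[OF X _ x y] by (simp add: isbell_L_le_iff[OF y] add.commute)
    show "gdist X x y \<le> isbell_L X (\<lambda>y\<in>points X. gdist X y x) y"
      using gdist_le_L_add[OF x y, of "\<lambda>y\<in>points X. gdist X y x"] x gdist_refl[OF X x]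
      by simp
  qed
  with y show "isbell_L X (\<lambda>y\<in>points X. gdist X y x) y = (\<lambda>y\<in>points X. gdist X x y) y"
    by simp
qed simp_all

lemma yoneda_mem:
  assumes X: "gen_metric_space X" and x: "x \<in> points X"
  shows "yoneda X x \<in> points (isbell_completion X)"
  using isbell_L_representable[OF X x] isbell_L_representable[of "op_gms X" x] X x
  by (simp add: mem_isbell_iff yoneda_def)

lemma short_map_yoneda:
  assumes X: "gen_metric_space X"
  shows "short_map X (isbell_completion X) (yoneda X)"
  unfolding short_map_def
proof (intro conjI ballI)
  show "yoneda X \<in> points X \<rightarrow> points (isbell_completion X)"
    using yoneda_mem[OF X] by blast
  fix x x' assume "x \<in> points X" "x' \<in> points X"
  then show "gdist (isbell_completion X) (yoneda X x) (yoneda X x') \<le> gdist X x x'"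
    using gdist_triangle[OF X]
    by (simp add: isbell_dist_le_iff_snd[OF X] yoneda_mem[OF X]) (simp add: yoneda_def)
qed

lemma is_colimit_yoneda:
  assumes X: "gen_metric_space X" and J: "J \<in> points D \<rightarrow> points X"
    and c: "is_colimit X D J W c"
  shows "is_colimit (isbell_completion X) D (yoneda X \<circ> J) W (yoneda X c)"
proof (rule is_colimit_isbellI[OF X])
  show "yoneda X \<circ> J \<in> points D \<rightarrow> points (isbell_completion X)"
    using J yoneda_mem[OF X] by (simp add: Pi_iff)
  show "yoneda X c \<in> points (isbell_completion X)"
    using c yoneda_mem[OF X] by (simp add: is_colimit_def)
  show "snd (yoneda X c) y = (SUP d\<in>points D. snd ((yoneda X \<circ> J) d) y \<ominus> W d)"
    if "y \<in> points X" for y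
    using c that by (simp add: is_colimit_def yoneda_def)
qed

section \<open>Duality\<close>

lemma swap_mem_isbell_op:
  "prod.swap p \<in> points (isbell_completion (op_gms X)) \<longleftrightarrow>
     p \<in> points (isbell_completion X)"
  by (cases p) (auto simp: isbell_completion_def presheaf_space_def copresheaf_space_def)

lemma gdist_isbell_op:
  "gdist (isbell_completion (op_gms X)) (prod.swap p) (prod.swap q) =
     gdist (isbell_completion X) q p"
  by (rule eq_by_upper_bounds) (simp add: gdist_isbell_le_iff conj_commute)

lemma is_limit_isbell_iff:
  "is_limit (isbell_completion X) D J W l \<longleftrightarrow>
     is_colimit (isbell_completion (op_gms X)) D (prod.swap \<circ> J) W (prod.swap l)"
proof -
  have "(\<forall>z\<in>points (isbell_completion (op_gms X)). P z) \<longleftrightarrow>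
          (\<forall>z\<in>points (isbell_completion X). P (prod.swap z))" for P
    using swap_mem_isbell_op by (metis swap_swap)
  then show ?thesis
    by (simp add: is_limit_def is_colimit_def swap_mem_isbell_op gdist_isbell_op)
qed

lemma is_limit_iff_op: "is_limit X D J W l \<longleftrightarrow> is_colimit (op_gms X) D J W l"
  by (simp add: is_limit_def is_colimit_def)

lemma yoneda_op: "yoneda (op_gms X) x = prod.swap (yoneda X x)"
  by (simp add: yoneda_def)

lemma isbell_limit_exists:
  assumes X: "gen_metric_space X"
    and J: "J \<in> points D \<rightarrow> points (isbell_completion X)"
  shows "\<exists>l. is_limit (isbell_completion X) D J W l"
proof -
  have "prod.swap \<circ> J \<in> points D \<rightarrow> points (isbell_completion (op_gms X))"
    using J by (simp add: Pi_iff swap_mem_isbell_op)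
  then obtain c where
    "is_colimit (isbell_completion (op_gms X)) D (prod.swap \<circ> J) W c"
    using isbell_colimit_exists X by (metis gen_metric_space_op)
  then have "is_limit (isbell_completion X) D J W (prod.swap c)"
    by (simp add: is_limit_isbell_iff)
  then show ?thesis ..
qed

lemma is_limit_yoneda:
  assumes X: "gen_metric_space X" and J: "J \<in> points D \<rightarrow> points X"
    and l: "is_limit X D J W l"
  shows "is_limit (isbell_completion X) D (yoneda X \<circ> J) W (yoneda X l)"
proof -
  have "prod.swap \<circ> (yoneda X \<circ> J) = yoneda (op_gms X) \<circ> J"
    by (simp add: fun_eq_iff yoneda_op)
  moreover have "is_colimit (op_gms X) D J W l"
    using l by (simp add: is_limit_iff_op)
  ultimately show ?thesis
    using is_colimit_yoneda[of "op_gms X" J D W l] X J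
    by (simp add: is_limit_isbell_iff yoneda_op)
qed

section \<open>Completeness and continuity\<close>

theorem mainTheorem1:
  fixes X :: "'a gms"
  assumes "gen_metric_space X"
  shows "gms_complete TYPE('d) (isbell_completion X) \<and>
         gms_cocomplete TYPE('d) (isbell_completion X) \<and>
         gms_continuous TYPE('d) X (isbell_completion X) (yoneda X) \<and>
         gms_cocontinuous TYPE('d) X (isbell_completion X) (yoneda X)"
proof (intro conjI)
  note X = assms
  show "gms_complete TYPE('d) (isbell_completion X)"
    using gen_metric_space_isbell[OF X] isbell_limit_exists[OF X]
    by (auto simp: gms_complete_def short_map_def)
  show "gms_cocomplete TYPE('d) (isbell_completion X)"
    using gen_metric_space_isbell[OF X] isbell_colimit_exists[OF X]
    by (auto simp: gms_cocomplete_def short_map_def)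
  show "gms_continuous TYPE('d) X (isbell_completion X) (yoneda X)"
    using short_map_yoneda[OF X] is_limit_yoneda[OF X]
    by (auto simp: gms_continuous_def short_map_def[of _ X])
  show "gms_cocontinuous TYPE('d) X (isbell_completion X) (yoneda X)"
    using short_map_yoneda[OF X] is_colimit_yoneda[OF X]
    by (auto simp: gms_cocontinuous_def short_map_def[of _ X])
qed

end
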